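(* Consider the potential stochastic Nash game and the (delay-free) asynchronous inexact best-response scheme described in the context, under the assumptions (A1), (A2), (A3) listed there. Suppose moreover that for every $i\in\mathcal N$, $f_i(x_i,x_{-i})$ is $\mu_i$-strongly convex in $x_i\in X_i$ (with $\mu_i>0$) for all $x_{-i}\in X_{-i}$. Let $\{x(k)\}$ be the sequence generated by the scheme. Then for almost all $\omega$, every limit point of $\{x(k,\omega)\}$ is a Nash equilibrium.
   Context: **Game.** Players $\mathcal N=\{1,\dots,N\}$; player $i$ has strategy $x_i\in X_i\subset\mathbb R^{n_i}$; $X=\prod_{i=1}^N X_i$, $X_{-i}=\prod_{j\ne i}X_j$, $x_{-i}=(x_j)_{j\neq i}$. Given $x_{-i}$, player $i$ solves $\min_{x_i\in X_i} f_i(x_i,x_{-i})$ with $f_i(x_i,x_{-i})=\mathbb E_\xi[\psi_i(x_i,x_{-i};\xi)]$, where $\xi$ is an $\mathbb R^d$-valued random vector and $\psi_i$ is scalar-valued. A Nash equilibrium is $x^*\in X$ with $f_i(x_i^*,x_{-i}^* )\le f_i(x_i,x_{-i}^* )$ for all $x_i\in X_i$ and all $i\in\mathcal N$. $\|\cdot\|$ is the Euclidean norm. **(A1)** (a) Each $X_i$ is closed, compact and convex. (b) For every $i$, $f_i(x_i,x_{-i})$ is convex and continuously differentiable in $x_i\in X_i$ for every $x_{-i}\in X_{-i}$, and there is $L_i>0$ with $\|\nabla_{x_i}f_i(x)-\nabla_{x_i}f_i(x')\|\le L_i\|x-x'\|$ for all $x,x'\in X$. (c) For every $i$, all $x_{-i}\in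 X_{-i}$ and every realization of $\xi$, $\psi_i(x_i,x_{-i};\xi)$ is differentiable in $x_i$ over an open set containing $X_i$, with $\nabla_{x_i}f_i(x_i,x_{-i})=\mathbb E_\xi[\nabla_{x_i}\psi_i(x_i,x_{-i};\xi)]$. (d) There is a constant $M>0$ such that $\mathbb E_\xi[\|\nabla_{x_i}\psi_i(x_i,x_{-i};\xi)\|^2]\le M^2$ for every $i$ and every $x\in X$. **(A2)** There is a function $P:X\to\mathbb R$, continuously differentiable over an open set containing $X$, such that for every $i$ and $x_{-i}\in X_{-i}$, $P(x_i,x_{-i})-P(x_i',x_{-i})=f_i(x_i,x_{-i})-f_i(x_i',x_{-i})$ for all $x_i,x_i'\in X_i$. **Best response.** $\widehat T_i(x)=\arg\min_{y_i\in X_i}f_i(y_i,x_{-i})$. **Scheme.** Start with $x_i(0)\in X_i$; fix $0<p_i<1$ with $\sum_ip_i=1$. At iteration $k\ge0$, a player $i_k$ is picked randomly with $\mathbb P(i_k=i)=p_i$. If $i_k=i$, then $x_i(k+1)=\widehat T_i(x(k))+\varepsilon_i(k+1)\in X_i$, and $x_j(k+1)=x_j(k)$ for $j\ne i_k$. Here $\varepsilon_i(k+1)$ is the random inexactness error of player $i$, arising from computing $\widehat T_i(x(k))$ approximately using a random sample vector $\xi_i(k)$ (finitely many realizations of $\xi$). Let $\mathcal F_k=\sigma\{x(0),i_l,\xi_{i_l}(l):0\le l\le k-1\}$ be the $\sigma$-field of all information used up to and including the update of $x(k)$, so $x(k)$ is $\mathcal F_k$-measurable. **(A3)** For every $i\in\mathcal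 N$, $\sum_{k=1}^\infty\mathbb E[\|\varepsilon_i(k+1)\|^2\mid\mathcal F_k]<\infty$ a.s. and $\sum_{k=1}^\infty\mathbb E[\|\varepsilon_i(k+1)\|\mid\mathcal F_k]<\infty$ a.s.; moreover $i_k$ is independent of $\mathcal F_k$ for all $k\ge1$. *)

theory Defs
  imports "HOL-Probability.Probability"
begin

text \<open>
  Joint strategies live in \<open>real ^ 'n\<close>, where \<open>'n\<close> indexes all coordinates of all players
  and \<open>blk :: 'n \<Rightarrow> 'i\<close> assigns to each coordinate the player who controls it. Player \<open>i\<close>'s space
  R^{n_i}, with n_i the number of coordinates \<open>c\<close> with \<open>blk c = i\<close>, is the coordinate subspace
  \<open>player_space blk i\<close>. So the players may have different dimensions, and the norm of
  \<open>real ^ 'n\<close> is the Euclidean norm both on joint strategies and on each R^{n_i}.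
\<close>

definition player_space :: "('n::finite \<Rightarrow> 'i) \<Rightarrow> 'i \<Rightarrow> (real ^ 'n) set" where
  "player_space blk i = {v. \<forall>c. blk c \<noteq> i \<longrightarrow> v $ c = 0}"

definition strategy :: "('n::finite \<Rightarrow> 'i) \<Rightarrow> 'i \<Rightarrow> real ^ 'n \<Rightarrow> real ^ 'n" where
  "strategy blk i x = (\<chi> c. if blk c = i then x $ c else 0)"

definition profiles :: "('n::finite \<Rightarrow> 'i) \<Rightarrow> ('i \<Rightarrow> (real ^ 'n) set) \<Rightarrow> (real ^ 'n) set" where
  "profiles blk X = {x. \<forall>i. strategy blk i x \<in> X i}"

text \<open>
  \<open>deviate blk i y x\<close> is the joint strategy \<open>(y\<^sub>i, x\<^sub>-\<^sub>i)\<close>. It ignores the coordinates of \<open>x\<close>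
  belonging to player \<open>i\<close>, so quantifying over \<open>x\<close> in \<open>profiles blk X\<close> amounts to quantifying over
  \<open>x\<^sub>-\<^sub>i\<close>. It also ignores the coordinates of \<open>y\<close> outside block \<open>i\<close>, so the gradient in \<open>y\<close>
  over all of \<open>real ^ 'n\<close> of a function of \<open>deviate blk i y x\<close> is the partial gradient with respect
  to player \<open>i\<close>'s strategy, and lies in \<open>player_space blk i\<close>.
\<close>

definition deviate :: "('n::finite \<Rightarrow> 'i) \<Rightarrow> 'i \<Rightarrow> real ^ 'n \<Rightarrow> real ^ 'n \<Rightarrow> real ^ 'n" where
  "deviate blk i y x = (\<chi> c. if blk c = i then y $ c else x $ c)"

definition nash_equilibrium ::
  "('n::finite \<Rightarrow> 'i) \<Rightarrow> ('i \<Rightarrow> (real ^ 'n) set) \<Rightarrow> ('i \<Rightarrow> real ^ 'n \<Rightarrow> real) \<Rightarrow> real ^ 'n \<Rightarrow> bool" where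
  "nash_equilibrium blk X f x \<longleftrightarrow>
     x \<in> profiles blk X \<and> (\<forall>i. \<forall>y\<in>X i. f i x \<le> f i (deviate blk i y x))"

text \<open>
  \<open>ARG_MIN\<close> picks an arbitrary minimiser. Here it is unique: it exists when \<open>X i\<close> is compact and
  nonempty and \<open>f i\<close> is continuous in player \<open>i\<close>'s strategy, and strong convexity gives uniqueness.
\<close>

definition best_response ::
  "('n::finite \<Rightarrow> 'i) \<Rightarrow> ('i \<Rightarrow> (real ^ 'n) set) \<Rightarrow> ('i \<Rightarrow> real ^ 'n \<Rightarrow> real) \<Rightarrow> 'i \<Rightarrow> real ^ 'n \<Rightarrow> real ^ 'n"
  where
  "best_response blk X f i x = (ARG_MIN (\<lambda>y. f i (deviate blk i y x)) y. y \<in> X i)"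

definition strongly_convex_on :: "real \<Rightarrow> 'a::real_normed_vector set \<Rightarrow> ('a \<Rightarrow> real) \<Rightarrow> bool" where
  "strongly_convex_on \<mu> S h \<longleftrightarrow> convex S \<and>
     (\<forall>y\<in>S. \<forall>z\<in>S. \<forall>t\<in>{0..1}. h ((1 - t) *\<^sub>R y + t *\<^sub>R z)
        \<le> (1 - t) * h y + t * h z - \<mu> / 2 * (t * (1 - t)) * (norm (y - z))\<^sup>2)"

text \<open>
  The sigma-field generated by \<open>x(0)\<close> and, for all \<open>l < k\<close>, by the selected player \<open>pick l\<close> and the
  sample vector of that player at iteration \<open>l\<close>. The sample vector of player \<open>i\<close> at iteration \<open>l\<close>
  consists of the first \<open>m i l\<close> terms of \<open>samp i l 0, samp i l 1, ...\<close>. The length \<open>m i l\<close> may be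
  random; taking \<open>A = UNIV\<close> in the last family of generators shows that it is part of the information.
\<close>

definition info ::
  "'w measure \<Rightarrow> ('w \<Rightarrow> real ^ 'n::finite) \<Rightarrow> (nat \<Rightarrow> 'w \<Rightarrow> 'i) \<Rightarrow> ('i \<Rightarrow> nat \<Rightarrow> 'w \<Rightarrow> nat)
     \<Rightarrow> ('i \<Rightarrow> nat \<Rightarrow> nat \<Rightarrow> 'w \<Rightarrow> real ^ 'd::finite) \<Rightarrow> nat \<Rightarrow> 'w measure" where
  "info M x0 pick m samp k = sigma (space M)
     ({x0 -` A \<inter> space M | A. A \<in> sets borel}
      \<union> {{w \<in> space M. pick l w = i} | l i. l < k}
      \<union> {{w \<in> space M. s < m (pick l w) l w \<and> samp (pick l w) l s w \<in> A} | l s A.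
           l < k \<and> A \<in> sets borel})"

end

theory Submission
  imports Defs
begin

text \<open>
  Measure how far a joint strategy \<open>z\<close> is from equilibrium by the gains: \<open>gain blk X f i z\<close> is the
  amount by which player \<open>i\<close> can lower the cost by switching to a best response. Gains are
  nonnegative, and they all vanish exactly at the Nash equilibria. In a potential game the gain is
  a drop of the potential \<open>P\<close>, which is Lipschitz on the compact convex set of joint strategies,
  so the gain is continuous. It is therefore enough to show that almost surely every gain tends to
  0 along the scheme (\<open>nash_equilibrium_if_no_gain\<close>, \<open>gain_lipschitz\<close>).

  A move of player \<open>i\<close> with error \<open>e\<close> lowers \<open>P\<close> by at least the gain minus \<open>K * norm e\<close>. The
  errors are almost surely summable, because their conditional expectations are
  (\<open>AE_summable_if_cond_exp_summable\<close>). As \<open>P\<close> is bounded, the gains of the players who actually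
  move are summable on almost every path (\<open>summable_gain_of_movers\<close>).

  This says nothing yet about a player at the steps where others move. Randomness closes the gap:
  player \<open>i\<close> is picked with probability \<open>p i > 0\<close> independently of the past, and the current gain
  is determined by the past, so the conditional expectation of the gain realised by player \<open>i\<close> at
  a step is \<open>p i\<close> times the current gain. For bounded terms, summability of the realised values
  entails summability of these conditional expectations
  (\<open>AE_summable_of_summable_on_indep_events\<close>), so the gain of every player is summable over all
  steps and in particular tends to 0.
\<close>

section \<open>Conditional summability\<close>

text \<open>
  Convergence passes from one series of nonnegative random variables to another if truncation makes
  their terms interchangeable in expectation. Restricted to the events \<open>A a n\<close>, the two series have the same
  integral, and the one of \<open>U\<close> is at most \<open>c a\<close> everywhere: a truncated partial sum is part of
  the full partial sum up to the last index \<open>n\<close> with \<open>w \<in> A a n\<close>. So the truncated series of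
  \<open>V\<close> is finite almost surely, and wherever \<open>\<Sum>n. U n w\<close> is finite some level \<open>a\<close> truncates
  nothing. In the applications \<open>A a n\<close> says that the time of crossing level \<open>a\<close> has not passed.
\<close>

lemma AE_suminf_finite_transfer:
  fixes U V :: "nat \<Rightarrow> 'w \<Rightarrow> ennreal"
  assumes "finite_measure M"
    and U [measurable]: "\<And>n. U n \<in> borel_measurable M"
    and V [measurable]: "\<And>n. V n \<in> borel_measurable M"
    and A [measurable]: "\<And>a n. A a n \<in> sets M"
    and eq: "\<And>a n. (\<integral>\<^sup>+w. indicator (A a n) w * U n w \<partial>M) = (\<integral>\<^sup>+w. indicator (A a n) w * V n w \<partial>M)"
    and bound: "\<And>a n w. w \<in> A a n \<Longrightarrow> (\<Sum>j\<le>n. U j w) \<le> c a"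
    and c: "\<And>a. c a < \<infinity>"
    and cover: "\<And>w. w \<in> space M \<Longrightarrow> (\<Sum>n. U n w) < \<infinity> \<Longrightarrow> \<exists>a::nat. \<forall>n. w \<in> A a n"
  shows "AE w in M. (\<Sum>n. U n w) < \<infinity> \<longrightarrow> (\<Sum>n. V n w) < \<infinity>"
proof -
  interpret finite_measure M by fact
  have "AE w in M. (\<Sum>n. indicator (A a n) w * V n w) \<noteq> \<infinity>" for a
  proof (rule nn_integral_noteq_infinite)
    have partial: "(\<Sum>n<N. indicator (A a n) w * U n w) \<le> c a" for N w
    proof (induction N)
      case (Suc N)
      show ?case
      proof (cases "w \<in> A a N")
        case True
        have "(\<Sum>n<Suc N. indicator (A a n) w * U n w) \<le> (\<Sum>n\<le>N. U n w)"
          unfolding lessThan_Suc_atMost by (intro sum_mono) (auto simp: indicator_def)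
        also have "\<dots> \<le> c a" using bound True .
        finally show ?thesis .
      qed (use Suc in simp)
    qed simp
    have "(\<integral>\<^sup>+w. (\<Sum>n. indicator (A a n) w * V n w) \<partial>M)
        = (\<Sum>n. \<integral>\<^sup>+w. indicator (A a n) w * V n w \<partial>M)"
      by (rule nn_integral_suminf) measurable
    also have "\<dots> = (\<Sum>n. \<integral>\<^sup>+w. indicator (A a n) w * U n w \<partial>M)"
      by (simp add: eq)
    also have "\<dots> = (\<integral>\<^sup>+w. (\<Sum>n. indicator (A a n) w * U n w) \<partial>M)"
      by (rule nn_integral_suminf[symmetric]) measurable
    also have "\<dots> \<le> (\<integral>\<^sup>+w. c a \<partial>M)"
      unfolding suminf_eq_SUP by (intro nn_integral_mono SUP_least partial)
    also have "\<dots> < \<infinity>"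
      using c[of a] emeasure_real[of "space M"] by (auto simp: ennreal_mult_less_top)
    finally show "(\<integral>\<^sup>+w. (\<Sum>n. indicator (A a n) w * V n w) \<partial>M) \<noteq> \<infinity>" by simp
  qed measurable
  then have "AE w in M. \<forall>a. (\<Sum>n. indicator (A a n) w * V n w) \<noteq> \<infinity>"
    by (subst AE_all_countable) blast
  moreover have "AE w in M. w \<in> space M" by simp
  ultimately show ?thesis
  proof eventually_elim
    case (elim w)
    show ?case
    proof
      assume "(\<Sum>n. U n w) < \<infinity>"
      then obtain a where "\<forall>n. w \<in> A a n" using cover elim by blast
      then show "(\<Sum>n. V n w) < \<infinity>"
        using elim(1)[rule_format, of a] by (simp add: less_top)
    qed
  qed
qed

lemma exists_nat_ge_ennreal:
  fixes s :: ennreal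
  assumes "s < \<infinity>"
  shows "\<exists>a::nat. s \<le> of_nat a"
  using ennreal_Ex_less_of_nat[of s] assms by (auto intro: less_imp_le)

lemma sum_measurable_subfiltration:
  fixes U :: "nat \<Rightarrow> 'w \<Rightarrow> ennreal"
  assumes "\<And>j. j \<in> J \<Longrightarrow> subalgebra G (F j)" "\<And>j. j \<in> J \<Longrightarrow> U j \<in> borel_measurable (F j)"
  shows "(\<lambda>w. \<Sum>j\<in>J. U j w) \<in> borel_measurable G"
  by (intro borel_measurable_sum measurable_from_subalg[OF assms(1) assms(2)])

text \<open>
  Half of Levy's extension of the Borel--Cantelli lemma. The partial sum of the conditional
  expectations up to and including index \<open>n\<close> is known at time \<open>n\<close>, so the truncating event is in
  \<open>F n\<close> and \<open>Z n\<close> may be replaced by its conditional expectation on it.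
\<close>

lemma AE_summable_if_cond_exp_summable:
  fixes Z :: "nat \<Rightarrow> 'w \<Rightarrow> ennreal"
  assumes "finite_measure M"
    and subalg: "\<And>n. subalgebra M (F n)"
    and mono: "\<And>j n. j \<le> n \<Longrightarrow> subalgebra (F n) (F j)"
    and Z [measurable]: "\<And>n. Z n \<in> borel_measurable M"
  shows "AE w in M. (\<Sum>n. nn_cond_exp M (F n) (Z n) w) < \<infinity> \<longrightarrow> (\<Sum>n. Z n w) < \<infinity>"
proof -
  define C where "C n = nn_cond_exp M (F n) (Z n)" for n
  define A where "A a n = {w \<in> space (F n). (\<Sum>j\<le>n. C j w) \<le> of_nat a}" for a n :: nat
  have C_F [measurable]: "C n \<in> borel_measurable (F n)" for n
    unfolding C_def by simp
  have "(\<lambda>w. \<Sum>j\<le>n. C j w) \<in> borel_measurable (F n)" for n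
    by (rule sum_measurable_subfiltration[where F = F]) (auto intro: mono)
  note [measurable] = this
  have A_F [measurable]: "A a n \<in> sets (F n)" for a n
    unfolding A_def by measurable
  have space: "space (F n) = space M" for n
    using subalg[of n] by (simp add: subalgebra_def)
  show ?thesis
    unfolding C_def[symmetric]
  proof (rule AE_suminf_finite_transfer[where A = A and c = of_nat])
    fix a n
    interpret S: finite_measure_subalgebra M "F n"
      using assms(1) subalg by (simp add: finite_measure_subalgebra_def finite_measure_subalgebra_axioms_def)
    show "C n \<in> borel_measurable M" by (simp add: C_def)
    show "A a n \<in> sets M" using A_F subalg[of n] by (auto simp: subalgebra_def)
    show "(\<integral>\<^sup>+w. indicator (A a n) w * C n w \<partial>M) = (\<integral>\<^sup>+w. indicator (A a n) w * Z n w \<partial>M)"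
      unfolding C_def by (rule S.nn_cond_exp_intg) measurable
  next
    fix w assume "w \<in> space M" "(\<Sum>n. C n w) < \<infinity>"
    then obtain a where a: "(\<Sum>n. C n w) \<le> of_nat a" using exists_nat_ge_ennreal by blast
    have "(\<Sum>j\<le>n. C j w) \<le> of_nat a" for n
      using sum_le_suminf[of "\<lambda>n. C n w" "{..n}"] a by (auto intro: order_trans)
    then show "\<exists>a::nat. \<forall>n. w \<in> A a n" using \<open>w \<in> space M\<close> by (auto simp: A_def space)
  qed (auto simp: A_def assms(1) of_nat_less_top)
qed

text \<open>
  The other half. Only the terms strictly before \<open>n\<close> are known at time \<open>n\<close>, so a stopped sum
  can overshoot its level \<open>a\<close> by one term; the bound \<open>B\<close> on the terms limits the overshoot.
\<close>

lemma AE_cond_exp_summable_if_summable: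
  fixes Z :: "nat \<Rightarrow> 'w \<Rightarrow> ennreal"
  assumes "finite_measure M"
    and subalg: "\<And>n. subalgebra M (F n)"
    and mono: "\<And>j n. j \<le> n \<Longrightarrow> subalgebra (F n) (F j)"
    and Z: "\<And>n. Z n \<in> borel_measurable (F (Suc n))"
    and bound: "\<And>n w. w \<in> space M \<Longrightarrow> Z n w \<le> B"
    and B: "B < \<infinity>"
  shows "AE w in M. (\<Sum>n. Z n w) < \<infinity> \<longrightarrow> (\<Sum>n. nn_cond_exp M (F n) (Z n) w) < \<infinity>"
proof -
  define A where "A a n = {w \<in> space (F n). (\<Sum>j<n. Z j w) \<le> of_nat a}" for a n :: nat
  have "(\<lambda>w. \<Sum>j<n. Z j w) \<in> borel_measurable (F n)" for n
    by (rule sum_measurable_subfiltration[where F = "\<lambda>j. F (Suc j)"]) (auto intro: mono Z)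
  note [measurable] = this
  have A_F [measurable]: "A a n \<in> sets (F n)" for a n
    unfolding A_def by measurable
  have space: "space (F n) = space M" for n
    using subalg[of n] by (simp add: subalgebra_def)
  have Z_M [measurable]: "Z n \<in> borel_measurable M" for n
    using measurable_from_subalg[OF subalg Z] .
  show ?thesis
  proof (rule AE_suminf_finite_transfer[where A = A and c = "\<lambda>a. of_nat a + B"])
    fix a n
    interpret S: finite_measure_subalgebra M "F n"
      using assms(1) subalg by (simp add: finite_measure_subalgebra_def finite_measure_subalgebra_axioms_def)
    show "A a n \<in> sets M" using A_F subalg[of n] by (auto simp: subalgebra_def)
    show "(\<integral>\<^sup>+w. indicator (A a n) w * Z n w \<partial>M)
        = (\<integral>\<^sup>+w. indicator (A a n) w * nn_cond_exp M (F n) (Z n) w \<partial>M)"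
      by (rule S.nn_cond_exp_intg[symmetric]) measurable
  next
    fix a n w assume "w \<in> A a n"
    then show "(\<Sum>j\<le>n. Z j w) \<le> of_nat a + B"
      unfolding lessThan_Suc_atMost[symmetric] sum.lessThan_Suc
      by (intro add_mono bound) (auto simp: A_def space)
  next
    fix w assume "w \<in> space M" "(\<Sum>n. Z n w) < \<infinity>"
    then obtain a where a: "(\<Sum>n. Z n w) \<le> of_nat a" using exists_nat_ge_ennreal by blast
    have "(\<Sum>j<n. Z j w) \<le> of_nat a" for n
      using sum_le_suminf[of "\<lambda>n. Z n w" "{..<n}"] a by (auto intro: order_trans)
    then show "\<exists>a::nat. \<forall>n. w \<in> A a n" using \<open>w \<in> space M\<close> by (auto simp: A_def space)
  qed (use B in \<open>auto simp: assms(1) of_nat_less_top\<close>)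
qed

lemma (in prob_space) nn_cond_exp_indicator_indep:
  assumes subalg: "subalgebra M F" and indep: "indep_set \<E> (sets F)" and E: "E \<in> \<E>"
  shows "AE w in M. nn_cond_exp M F (indicator E) w = ennreal (prob E)"
proof -
  interpret S: finite_measure_subalgebra M F by unfold_locales fact
  have E_M [measurable]: "E \<in> events" using indep_setD_ev1[OF indep] E by blast
  have "AE w in M. ennreal (prob E) = nn_cond_exp M F (indicator E) w"
  proof (rule S.nn_cond_exp_charact)
    fix A assume A: "A \<in> sets F"
    then have [measurable]: "A \<in> events" using subalg by (auto simp: subalgebra_def)
    have "(\<integral>\<^sup>+w\<in>A. indicator E w \<partial>M) = (\<integral>\<^sup>+w. indicator (E \<inter> A) w \<partial>M)"
      by (simp add: indicator_inter_arith)
    also have "\<dots> = emeasure M (E \<inter> A)" by simp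
    also have "\<dots> = ennreal (prob E * prob A)"
      using indep_setD[OF indep E A] by (simp add: emeasure_eq_measure)
    also have "\<dots> = (\<integral>\<^sup>+w\<in>A. ennreal (prob E) \<partial>M)"
      by (simp add: nn_integral_cmult emeasure_eq_measure ennreal_mult)
    finally show "(\<integral>\<^sup>+w\<in>A. indicator E w \<partial>M) = (\<integral>\<^sup>+w\<in>A. ennreal (prob E) \<partial>M)" .
  qed auto
  then show ?thesis by eventually_elim simp
qed

text \<open>
  Each index is selected with the same positive probability \<open>q\<close>, independently of the past that
  determines the corresponding term, so the conditional expectation of the selected term is
  \<open>q * D n\<close>. Hence convergence along the selected indices forces convergence altogether.
\<close>

lemma (in prob_space) AE_summable_of_summable_on_indep_events:
  fixes D :: "nat \<Rightarrow> 'a \<Rightarrow> real"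
  assumes subalg: "\<And>n. subalgebra M (F n)"
    and mono: "\<And>j n. j \<le> n \<Longrightarrow> subalgebra (F n) (F j)"
    and indep: "\<And>n. indep_set (\<E> n) (sets (F n))"
    and E: "\<And>n. E n \<in> \<E> n" "\<And>n. E n \<in> sets (F (Suc n))"
    and q: "\<And>n. prob (E n) = q" "q > 0"
    and D: "\<And>n. D n \<in> borel_measurable (F n)"
    and D_bounds: "\<And>n w. w \<in> space M \<Longrightarrow> 0 \<le> D n w" "\<And>n w. w \<in> space M \<Longrightarrow> D n w \<le> B"
  shows "AE w in M. summable (\<lambda>n. if w \<in> E n then D n w else 0) \<longrightarrow> summable (\<lambda>n. D n w)"
proof -
  define Z where "Z n w = ennreal (D n w) * indicator (E n) w" for n w
  have "AE w in M. (\<Sum>n. Z n w) < \<infinity> \<longrightarrow> (\<Sum>n. nn_cond_exp M (F n) (Z n) w) < \<infinity>"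
  proof (rule AE_cond_exp_summable_if_summable[where F = F])
    show "finite_measure M" by unfold_locales
    fix n
    have "(\<lambda>w. ennreal (D n w)) \<in> borel_measurable (F (Suc n))"
      by (intro measurable_compose[OF _ measurable_ennreal] measurable_from_subalg[OF mono[of n "Suc n"] D]) simp
    then show "Z n \<in> borel_measurable (F (Suc n))"
      using E(2)[of n] unfolding Z_def by measurable
    show "Z n w \<le> ennreal B" if "w \<in> space M" for w
      using D_bounds[OF that] by (auto simp: Z_def indicator_def intro: ennreal_leI)
  qed (auto intro: subalg mono)
  moreover have "AE w in M. \<forall>n. nn_cond_exp M (F n) (Z n) w = ennreal (D n w) * ennreal q"
  proof (subst AE_all_countable, rule allI)
    fix n
    interpret S: finite_measure_subalgebra M "F n" by unfold_locales (rule subalg)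
    have [measurable]: "D n \<in> borel_measurable (F n)" by (rule D)
    have [measurable]: "E n \<in> events" using indep_setD_ev1[OF indep] E by blast
    have "AE w in M. ennreal (D n w) * nn_cond_exp M (F n) (indicator (E n)) w = nn_cond_exp M (F n) (Z n) w"
      unfolding Z_def by (rule S.nn_cond_exp_prod) measurable
    with nn_cond_exp_indicator_indep[OF subalg indep E(1), of n]
    show "AE w in M. nn_cond_exp M (F n) (Z n) w = ennreal (D n w) * ennreal q"
      by eventually_elim (simp add: q)
  qed
  moreover have "AE w in M. w \<in> space M" by simp
  ultimately show ?thesis
  proof eventually_elim
    case (elim w)
    note D_nonneg = D_bounds(1)[OF elim(3)]
    show ?case
    proof
      assume sum: "summable (\<lambda>n. if w \<in> E n then D n w else 0)"
      have "Z n w = ennreal (if w \<in> E n then D n w else 0)" for n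
        by (simp add: Z_def)
      then have "(\<Sum>n. Z n w) < \<infinity>"
        using ennreal_suminf_neq_top[OF sum] D_nonneg by (simp add: less_top)
      then have "(\<Sum>n. nn_cond_exp M (F n) (Z n) w) \<noteq> \<infinity>"
        using elim(1) by auto
      moreover have "nn_cond_exp M (F n) (Z n) w = ennreal (D n w * q)" for n
        using elim(2) D_nonneg q(2) by (simp add: ennreal_mult)
      ultimately have "(\<Sum>n. ennreal (D n w * q)) \<noteq> \<infinity>" by simp
      then have "summable (\<lambda>n. D n w * q)"
        using D_nonneg q(2) by (intro summable_suminf_not_top) (auto intro: mult_nonneg_nonneg less_imp_le)
      then show "summable (\<lambda>n. D n w)"
        using summable_mult2[of "\<lambda>n. D n w * q" "1 / q"] q(2) by simp
    qed
  qed
qed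

section \<open>Joint strategies\<close>

lemma deviate_strategy [simp]: "deviate blk i (strategy blk i z) z = z"
  by (simp add: deviate_def strategy_def vec_eq_iff)

lemma norm_deviate_diff_others_le: "norm (deviate blk i y z - deviate blk i y z') \<le> norm (z - z')"
  by (rule norm_le_componentwise_cart) (simp add: deviate_def)

lemma norm_deviate_diff_own_le: "norm (deviate blk i y z - deviate blk i y' z) \<le> norm (y - y')"
  by (rule norm_le_componentwise_cart) (simp add: deviate_def)

lemma deviate_in_profiles:
  assumes "y \<in> X i" "X i \<subseteq> player_space blk i" "z \<in> profiles blk X"
  shows "deviate blk i y z \<in> profiles blk X"
proof -
  have "strategy blk i (deviate blk i y z) = y"
    using assms by (auto simp: strategy_def deviate_def player_space_def vec_eq_iff)
  moreover have "strategy blk j (deviate blk i y z) = strategy blk j z" if "j \<noteq> i" for j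
    using that by (auto simp: strategy_def deviate_def vec_eq_iff)
  ultimately show ?thesis
    using assms(1,3) unfolding profiles_def mem_Collect_eq by metis
qed

lemma bounded_linear_strategy: "bounded_linear (strategy blk i)"
proof -
  have "linear (strategy blk i)"
    by (rule linearI) (auto simp: strategy_def vec_eq_iff)
  then show ?thesis by (rule linear_conv_bounded_linear[THEN iffD1])
qed

lemma profiles_eq_vimage: "profiles blk X = (\<Inter>i. strategy blk i -` X i)"
  by (auto simp: profiles_def)

lemma convex_profiles: "(\<And>i. convex (X i)) \<Longrightarrow> convex (profiles blk X)"
  unfolding profiles_eq_vimage
  by (intro convex_INT convex_linear_vimage bounded_linear.linear bounded_linear_strategy)

lemma closed_profiles: "(\<And>i. closed (X i)) \<Longrightarrow> closed (profiles blk X)"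
  unfolding profiles_eq_vimage
  by (intro closed_INT ballI closed_vimage
      linear_continuous_on bounded_linear_strategy) auto

lemma sum_strategy: "(\<Sum>i\<in>UNIV. strategy blk i z) = z"
  for blk :: "'n::finite \<Rightarrow> 'i::finite"
  by (simp add: strategy_def vec_eq_iff if_distrib sum.delta cong: if_cong)

lemma compact_profiles:
  fixes blk :: "'n::finite \<Rightarrow> 'i::finite"
  assumes "\<And>i. compact (X i)"
  shows "compact (profiles blk X)"
proof -
  have "\<exists>B. \<forall>y\<in>X i. norm y \<le> B" for i
    using compact_imp_bounded[OF assms[of i]] by (simp add: bounded_iff)
  then obtain B where B: "\<And>i y. y \<in> X i \<Longrightarrow> norm y \<le> B i" by metis
  have "norm z \<le> (\<Sum>i\<in>UNIV. B i)" if "z \<in> profiles blk X" for z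
  proof -
    have "norm (\<Sum>i\<in>UNIV. strategy blk i z) \<le> (\<Sum>i\<in>UNIV. B i)"
      using that by (intro sum_norm_le B) (simp add: profiles_def)
    then show ?thesis by (simp add: sum_strategy)
  qed
  then have "bounded (profiles blk X)" unfolding bounded_iff by blast
  then show ?thesis
    using closed_profiles[of X] assms by (simp add: compact_eq_bounded_closed)
qed

text \<open>
  The gradient is bounded on the compact set, and convexity keeps the segment between two points
  inside it, so the mean value inequality applies.
\<close>

lemma C1_lipschitz_on_compact_convex:
  fixes P :: "'a::euclidean_space \<Rightarrow> real"
  assumes S: "compact S" "convex S" "S \<subseteq> U"
    and P: "\<And>z. z \<in> U \<Longrightarrow> GDERIV P z :> grad_P z" and cont: "continuous_on U grad_P"
  obtains K where "K-lipschitz_on S P"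
proof -
  have "bounded (grad_P ` S)"
    using S cont by (intro compact_imp_bounded compact_continuous_image) (auto intro: continuous_on_subset)
  then obtain K where K: "\<And>z. z \<in> S \<Longrightarrow> norm (grad_P z) \<le> K" "K > 0"
    unfolding bounded_pos by auto
  have "norm (P z - P z') \<le> K * norm (z - z')" if "z \<in> S" "z' \<in> S" for z z'
  proof (rule differentiable_bound[OF S(2) _ _ that])
    fix z assume z: "z \<in> S"
    show "(P has_derivative (\<lambda>h. h \<bullet> grad_P z)) (at z within S)"
      using P[of z] z S unfolding gderiv_def by (auto intro: has_derivative_at_withinI)
    show "onorm (\<lambda>h. h \<bullet> grad_P z) \<le> K"
    proof (rule onorm_le)
      fix h :: 'a
      have "\<bar>h \<bullet> grad_P z\<bar> \<le> norm h * norm (grad_P z)" by (rule Cauchy_Schwarz_ineq2)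
      also have "\<dots> \<le> norm h * K" using K(1)[OF z] by (intro mult_left_mono) auto
      finally show "norm (h \<bullet> grad_P z) \<le> K * norm h" by (simp add: mult.commute)
    qed
  qed
  then have "K-lipschitz_on S P"
    using K(2) by (intro lipschitz_onI) (auto simp: dist_norm)
  then show thesis by (rule that)
qed

section \<open>Potential games and the gain from a best response\<close>

definition gain ::
  "('n::finite \<Rightarrow> 'i) \<Rightarrow> ('i \<Rightarrow> (real ^ 'n) set) \<Rightarrow> ('i \<Rightarrow> real ^ 'n \<Rightarrow> real) \<Rightarrow> 'i \<Rightarrow> real ^ 'n \<Rightarrow> real"
  where "gain blk X f i z = f i z - f i (deviate blk i (best_response blk X f i z) z)"

locale lipschitz_potential_game =
  fixes blk :: "'n::finite \<Rightarrow> 'i::finite"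
    and X :: "'i \<Rightarrow> (real ^ 'n) set"
    and f :: "'i \<Rightarrow> real ^ 'n \<Rightarrow> real"
    and P :: "real ^ 'n \<Rightarrow> real"
    and K :: real
  assumes X_sub: "\<And>i. X i \<subseteq> player_space blk i"
    and X_compact: "\<And>i. compact (X i)"
    and potential: "\<And>i z y y'. z \<in> profiles blk X \<Longrightarrow> y \<in> X i \<Longrightarrow> y' \<in> X i \<Longrightarrow>
          P (deviate blk i y z) - P (deviate blk i y' z)
            = f i (deviate blk i y z) - f i (deviate blk i y' z)"
    and P_lipschitz: "K-lipschitz_on (profiles blk X) P"
begin

lemma strategy_in: "z \<in> profiles blk X \<Longrightarrow> strategy blk i z \<in> X i"
  by (simp add: profiles_def)

lemma deviate_in: "y \<in> X i \<Longrightarrow> z \<in> profiles blk X \<Longrightarrow> deviate blk i y z \<in> profiles blk X"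
  by (rule deviate_in_profiles[OF _ X_sub])

lemma P_diff_le:
  "z \<in> profiles blk X \<Longrightarrow> z' \<in> profiles blk X \<Longrightarrow> P z \<le> P z' + K * norm (z - z')"
  using lipschitz_onD[OF P_lipschitz, of z z'] by (simp add: dist_norm abs_le_iff)

lemma K_nonneg: "0 \<le> K"
  using lipschitz_on_nonneg[OF P_lipschitz] .

text \<open>
  A player's cost differs from the potential only by a constant while the opponents stay put, so
  it inherits continuity from the potential and attains its minimum on the compact strategy set.
\<close>

lemma best_response:
  assumes z: "z \<in> profiles blk X"
  shows best_response_in: "best_response blk X f i z \<in> X i"
    and best_response_le:
      "\<And>y. y \<in> X i \<Longrightarrow> f i (deviate blk i (best_response blk X f i z) z) \<le> f i (deviate blk i y z)"
proof -
  have "continuous_on (X i) (\<lambda>y. f i (deviate blk i y z))"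
  proof (rule continuous_on_eq)
    show "P (deviate blk i y z) + (f i z - P z) = f i (deviate blk i y z)" if "y \<in> X i" for y
      using potential[OF z that strategy_in[OF z]] by simp
    have "continuous_on (X i) (\<lambda>y. deviate blk i y z)"
      by (intro lipschitz_on_continuous_on[of 1] lipschitz_onI)
        (auto simp: dist_norm norm_deviate_diff_own_le)
    then show "continuous_on (X i) (\<lambda>y. P (deviate blk i y z) + (f i z - P z))"
      by (intro continuous_intros continuous_on_compose2[OF lipschitz_on_continuous_on[OF P_lipschitz]])
        (auto intro: deviate_in z)
  qed
  then obtain y where "is_arg_min (\<lambda>y. f i (deviate blk i y z)) (\<lambda>y. y \<in> X i) y"
    using continuous_attains_inf[OF X_compact[of i], of "\<lambda>y. f i (deviate blk i y z)"] strategy_in[OF z]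
    by (auto simp: is_arg_min_linorder)
  then have "is_arg_min (\<lambda>y. f i (deviate blk i y z)) (\<lambda>y. y \<in> X i) (best_response blk X f i z)"
    unfolding best_response_def arg_min_def by (rule someI)
  then show "best_response blk X f i z \<in> X i"
    and "\<And>y. y \<in> X i \<Longrightarrow> f i (deviate blk i (best_response blk X f i z) z) \<le> f i (deviate blk i y z)"
    by (auto simp: is_arg_min_linorder)
qed

lemma gain_eq_potential_drop:
  assumes "z \<in> profiles blk X"
  shows "gain blk X f i z = P z - P (deviate blk i (best_response blk X f i z) z)"
  using potential[OF assms strategy_in[OF assms, of i] best_response_in[OF assms, of i]]
  by (simp add: gain_def)

lemma gain_nonneg: "z \<in> profiles blk X \<Longrightarrow> 0 \<le> gain blk X f i z"
  using best_response_le[OF _ strategy_in, of z z i] by (simp add: gain_def)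

lemma nash_equilibrium_if_no_gain:
  assumes z: "z \<in> profiles blk X" and "\<And>i. gain blk X f i z \<le> 0"
  shows "nash_equilibrium blk X f z"
  unfolding nash_equilibrium_def
proof (intro conjI allI ballI z)
  fix i y assume "y \<in> X i"
  then show "f i z \<le> f i (deviate blk i y z)"
    using best_response_le[OF z] assms(2)[of i] by (force simp: gain_def)
qed

text \<open>
  The gain is the potential minus its minimum over player \<open>i\<close>'s strategy, and both are
  \<open>K\<close>-Lipschitz. For the minimum, the best response at \<open>z\<close> is a competitor in the minimisation at
  \<open>z'\<close>, which bounds one minimum by the other.
\<close>

lemma gain_lipschitz: "(2 * K)-lipschitz_on (profiles blk X) (gain blk X f i)"
proof (rule lipschitz_onI)
  have le: "gain blk X f i z - gain blk X f i z' \<le> 2 * K * norm (z - z')"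
    if z: "z \<in> profiles blk X" and z': "z' \<in> profiles blk X" for z z'
  proof -
    let ?b = "best_response blk X f i z" and ?b' = "best_response blk X f i z'"
    have b: "?b \<in> X i" and b': "?b' \<in> X i" using best_response_in z z' by auto
    have "P (deviate blk i ?b' z') \<le> P (deviate blk i ?b z')"
      using best_response_le[OF z' b] potential[OF z' b b'] by simp
    also have "\<dots> \<le> P (deviate blk i ?b z) + K * norm (deviate blk i ?b z' - deviate blk i ?b z)"
      using P_diff_le deviate_in b z z' by blast
    also have "\<dots> \<le> P (deviate blk i ?b z) + K * norm (z - z')"
      using norm_deviate_diff_others_le[of blk i ?b z' z] K_nonneg
      by (simp add: mult_left_mono norm_minus_commute)
    finally show ?thesis
      using P_diff_le[OF z z'] by (simp add: gain_eq_potential_drop z z')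
  qed
  show "dist (gain blk X f i z) (gain blk X f i z') \<le> 2 * K * dist z z'"
    if "z \<in> profiles blk X" "z' \<in> profiles blk X" for z z'
    using le[OF that] le[OF that(2,1)] by (simp add: dist_norm norm_minus_commute abs_le_iff)
qed (use K_nonneg in simp)

lemma gain_le_potential_decrease:
  assumes z: "z \<in> profiles blk X" and e: "best_response blk X f i z + e \<in> X i"
  shows "gain blk X f i z \<le> P z - P (deviate blk i (best_response blk X f i z + e) z) + K * norm e"
proof -
  let ?b = "best_response blk X f i z"
  have "P (deviate blk i (?b + e) z)
      \<le> P (deviate blk i ?b z) + K * norm (deviate blk i (?b + e) z - deviate blk i ?b z)"
    by (intro P_diff_le deviate_in e best_response_in z)
  also have "\<dots> \<le> P (deviate blk i ?b z) + K * norm e"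
    using norm_deviate_diff_own_le[of blk i "?b + e" z ?b] K_nonneg by (simp add: mult_left_mono)
  finally show ?thesis by (simp add: gain_eq_potential_drop z)
qed

text \<open>
  Up to an error of at most \<open>K * norm (e k)\<close>, each move lowers the potential by the mover's gain.
  The potential is bounded, so telescoping bounds the total gain of the movers.
\<close>

lemma summable_gain_of_movers:
  assumes z: "\<And>k. z k \<in> profiles blk X"
    and move_in: "\<And>k. best_response blk X f (i k) (z k) + e k \<in> X (i k)"
    and move: "\<And>k. z (Suc k) = deviate blk (i k) (best_response blk X f (i k) (z k) + e k) (z k)"
    and e: "summable (\<lambda>k. norm (e k))"
  shows "summable (\<lambda>k. gain blk X f (i k) (z k))"
proof -
  have "bounded (P ` profiles blk X)"
    by (intro compact_imp_bounded compact_continuous_image compact_profiles X_compact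
        lipschitz_on_continuous_on[OF P_lipschitz])
  then obtain B where B: "\<And>k. \<bar>P (z k)\<bar> \<le> B"
    using z unfolding bounded_iff by (metis image_eqI real_norm_def)
  have telescoped: "(\<Sum>k<N. gain blk X f (i k) (z k)) \<le> P (z 0) - P (z N) + K * (\<Sum>k<N. norm (e k))" for N
  proof (induction N)
    case (Suc N)
    then show ?case
      using gain_le_potential_decrease[OF z move_in, of N] by (simp add: move[symmetric] distrib_left)
  qed simp
  have "(\<Sum>k<N. gain blk X f (i k) (z k)) \<le> 2 * B + K * (\<Sum>k. norm (e k))" for N
  proof -
    have "K * (\<Sum>k<N. norm (e k)) \<le> K * (\<Sum>k. norm (e k))"
      using e by (intro mult_left_mono sum_le_suminf K_nonneg) auto
    with telescoped[of N] show ?thesis using B[of 0] B[of N] by linarith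
  qed
  then show ?thesis
    by (intro summableI_nonneg_bounded[of _ "2 * B + K * (\<Sum>k. norm (e k))"] gain_nonneg z)
qed

end

section \<open>The information available along the scheme\<close>

lemma info_generators_subset:
  fixes x0 :: "'w \<Rightarrow> real ^ 'n::finite" and pick :: "nat \<Rightarrow> 'w \<Rightarrow> 'i"
    and samp :: "'i \<Rightarrow> nat \<Rightarrow> nat \<Rightarrow> 'w \<Rightarrow> real ^ 'd::finite"
  shows "{x0 -` A \<inter> space M | A. A \<in> sets borel}
      \<union> {{w \<in> space M. pick l w = i} | l i. l < k}
      \<union> {{w \<in> space M. s < m (pick l w) l w \<and> samp (pick l w) l s w \<in> A} | l s A.
           l < k \<and> A \<in> sets borel} \<subseteq> Pow (space M)"
  by auto

lemma space_info [simp]: "space (info M x0 pick m samp k) = space M"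
  unfolding info_def by (rule space_measure_of[OF info_generators_subset])

lemma subalgebra_info_mono:
  assumes "j \<le> k"
  shows "subalgebra (info M x0 pick m samp k) (info M x0 pick m samp j)"
proof -
  have "sets (info M x0 pick m samp j) \<subseteq> sets (info M x0 pick m samp k)"
    unfolding info_def sets_measure_of[OF info_generators_subset]
    using assms by (intro sigma_sets_mono') (blast intro: less_le_trans)
  then show ?thesis by (simp add: subalgebra_def)
qed

lemma pick_in_info: "l < k \<Longrightarrow> {w \<in> space M. pick l w = i} \<in> sets (info M x0 pick m samp k)"
  unfolding info_def sets_measure_of[OF info_generators_subset] by (rule sigma_sets.Basic) blast

text \<open>
  The sample read at step \<open>l\<close> is that of the randomly picked player; its events are measurable
  because they split into finitely many pieces, one for each player that may have been picked.
\<close>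

lemma subalgebra_info:
  fixes pick :: "nat \<Rightarrow> 'w \<Rightarrow> 'i::finite"
  assumes [measurable]: "x0 \<in> borel_measurable M"
    "\<And>k. pick k \<in> measurable M (count_space UNIV)"
    "\<And>i k. m i k \<in> measurable M (count_space UNIV)"
    "\<And>i k s. samp i k s \<in> borel_measurable M"
  shows "subalgebra M (info M x0 pick m samp k)"
proof -
  have "{w \<in> space M. s < m (pick l w) l w \<and> samp (pick l w) l s w \<in> A} \<in> sets M"
    if [measurable]: "A \<in> sets borel" for l s A
  proof -
    have "{w \<in> space M. s < m (pick l w) l w \<and> samp (pick l w) l s w \<in> A}
        = (\<Union>i. {w \<in> space M. pick l w = i \<and> s < m i l w \<and> samp i l s w \<in> A})"
      by auto
    also have "\<dots> \<in> sets M" by measurable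
    finally show ?thesis .
  qed
  then have "sets (info M x0 pick m samp k) \<subseteq> sets M"
    unfolding info_def sets_measure_of[OF info_generators_subset]
    by (intro sets.sigma_sets_subset) (auto intro: measurable_sets[OF assms(1)])
  then show ?thesis by (simp add: subalgebra_def)
qed

section \<open>Convergence to equilibria\<close>

theorem theorem3:
  fixes M :: "'w measure"
    and blk :: "'n::finite \<Rightarrow> 'i::finite"
    and X :: "'i \<Rightarrow> (real ^ 'n) set"
    and \<xi> :: "'w \<Rightarrow> real ^ 'd::finite"
    and \<psi> :: "'i \<Rightarrow> real ^ 'n \<Rightarrow> real ^ 'd \<Rightarrow> real"
    and f :: "'i \<Rightarrow> real ^ 'n \<Rightarrow> real"
    and grad_f :: "'i \<Rightarrow> real ^ 'n \<Rightarrow> real ^ 'n"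
    and grad_\<psi> :: "'i \<Rightarrow> real ^ 'n \<Rightarrow> real ^ 'd \<Rightarrow> real ^ 'n"
    and P :: "real ^ 'n \<Rightarrow> real"
    and \<mu> p :: "'i \<Rightarrow> real"
    and pick :: "nat \<Rightarrow> 'w \<Rightarrow> 'i"
    and m :: "'i \<Rightarrow> nat \<Rightarrow> 'w \<Rightarrow> nat"
    and samp :: "'i \<Rightarrow> nat \<Rightarrow> nat \<Rightarrow> 'w \<Rightarrow> real ^ 'd"
    and \<epsilon> :: "'i \<Rightarrow> nat \<Rightarrow> 'w \<Rightarrow> real ^ 'n"
    and x :: "nat \<Rightarrow> 'w \<Rightarrow> real ^ 'n"
  assumes prob: "prob_space M"
    and xi_meas: "\<xi> \<in> borel_measurable M"
    \<comment> \<open>the game\<close>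
    and X_sub: "\<And>i. X i \<subseteq> player_space blk i"
    and f_expectation: "\<And>i z. z \<in> profiles blk X \<Longrightarrow>
          integrable M (\<lambda>w. \<psi> i z (\<xi> w)) \<and> f i z = (\<integral>w. \<psi> i z (\<xi> w) \<partial>M)"
    \<comment> \<open>(A1)\<close>
    and A1a: "\<And>i. closed (X i) \<and> compact (X i) \<and> convex (X i)"
    and A1b_convex: "\<And>i z. z \<in> profiles blk X \<Longrightarrow>
          convex_on (X i) (\<lambda>y. f i (deviate blk i y z))"
    and A1b_grad: "\<And>i z. z \<in> profiles blk X \<Longrightarrow> grad_f i z \<in> player_space blk i \<and>
          ((\<lambda>y. f i (deviate blk i y z)) has_derivative (\<lambda>v. v \<bullet> grad_f i z))
            (at (strategy blk i z) within X i)"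
    and A1b_cont: "\<And>i z. z \<in> profiles blk X \<Longrightarrow>
          continuous_on (X i) (\<lambda>y. grad_f i (deviate blk i y z))"
    and A1b_lipschitz: "\<And>i. \<exists>L>0. L-lipschitz_on (profiles blk X) (grad_f i)"
    and A1c_diff: "\<And>i z w. z \<in> profiles blk X \<Longrightarrow> w \<in> space M \<Longrightarrow>
          \<exists>U. open U \<and> X i \<subseteq> U \<and>
            (\<forall>y\<in>U. GDERIV (\<lambda>y'. \<psi> i (deviate blk i y' z) (\<xi> w)) y
                      :> grad_\<psi> i (deviate blk i y z) (\<xi> w))"
    and A1c_interchange: "\<And>i z. z \<in> profiles blk X \<Longrightarrow>
          integrable M (\<lambda>w. grad_\<psi> i z (\<xi> w)) \<and> grad_f i z = (\<integral>w. grad_\<psi> i z (\<xi> w) \<partial>M)"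
    and A1d: "\<exists>C>0. \<forall>i. \<forall>z\<in>profiles blk X.
          integrable M (\<lambda>w. (norm (grad_\<psi> i z (\<xi> w)))\<^sup>2) \<and>
          (\<integral>w. (norm (grad_\<psi> i z (\<xi> w)))\<^sup>2 \<partial>M) \<le> C\<^sup>2"
    \<comment> \<open>(A2)\<close>
    and A2_smooth: "\<exists>U grad_P. open U \<and> profiles blk X \<subseteq> U \<and>
          (\<forall>z\<in>U. GDERIV P z :> grad_P z) \<and> continuous_on U grad_P"
    and A2_potential: "\<And>i z y y'. z \<in> profiles blk X \<Longrightarrow> y \<in> X i \<Longrightarrow> y' \<in> X i \<Longrightarrow>
          P (deviate blk i y z) - P (deviate blk i y' z)
            = f i (deviate blk i y z) - f i (deviate blk i y' z)"
    \<comment> \<open>strong convexity\<close>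
    and mu_pos: "\<And>i. \<mu> i > 0"
    and strongly_convex: "\<And>i z. z \<in> profiles blk X \<Longrightarrow>
          strongly_convex_on (\<mu> i) (X i) (\<lambda>y. f i (deviate blk i y z))"
    \<comment> \<open>the scheme\<close>
    and p_bounds: "\<And>i. 0 < p i \<and> p i < 1"
    and p_sum: "(\<Sum>i\<in>UNIV. p i) = 1"
    and pick_meas: "\<And>k. pick k \<in> measurable M (count_space UNIV)"
    and pick_prob: "\<And>k i. measure M {w \<in> space M. pick k w = i} = p i"
    and m_meas: "\<And>i k. m i k \<in> measurable M (count_space UNIV)"
    and samp_meas: "\<And>i k s. samp i k s \<in> borel_measurable M"
    and samp_distr: "\<And>i k s. distr M borel (samp i k s) = distr M borel \<xi>"
    and eps_meas: "\<And>i k. \<epsilon> i (Suc k) \<in> borel_measurable M"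
    and eps_space: "\<And>i k w. w \<in> space M \<Longrightarrow> \<epsilon> i (Suc k) w \<in> player_space blk i"
    and x0_meas: "x 0 \<in> borel_measurable M"
    and x0_in: "\<And>w. w \<in> space M \<Longrightarrow> x 0 w \<in> profiles blk X"
    and step_in: "\<And>k w i. w \<in> space M \<Longrightarrow> pick k w = i \<Longrightarrow>
          best_response blk X f i (x k w) + \<epsilon> i (Suc k) w \<in> X i"
    and step: "\<And>k w i. w \<in> space M \<Longrightarrow> pick k w = i \<Longrightarrow>
          x (Suc k) w
            = deviate blk i (best_response blk X f i (x k w) + \<epsilon> i (Suc k) w) (x k w)"
    and adapted: "\<And>k. x k \<in> borel_measurable (info M (x 0) pick m samp k)"
    \<comment> \<open>(A3)\<close>
    and A3_square: "\<And>i. AE w in M.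
          (\<Sum>k. nn_cond_exp M (info M (x 0) pick m samp (Suc k))
                 (\<lambda>w. ennreal ((norm (\<epsilon> i (Suc (Suc k)) w))\<^sup>2)) w) < \<infinity>"
    and A3_norm: "\<And>i. AE w in M.
          (\<Sum>k. nn_cond_exp M (info M (x 0) pick m samp (Suc k))
                 (\<lambda>w. ennreal (norm (\<epsilon> i (Suc (Suc k)) w))) w) < \<infinity>"
    and A3_indep: "\<And>k. k \<ge> 1 \<Longrightarrow> prob_space.indep_set M
          (sets (vimage_algebra (space M) (pick k) (count_space UNIV)))
          (sets (info M (x 0) pick m samp k))"
  shows "AE w in M. \<forall>z. (\<exists>r. strict_mono r \<and> ((\<lambda>k. x k w) \<circ> r) \<longlonglongrightarrow> z)
           \<longrightarrow> nash_equilibrium blk X f z"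
proof -
  interpret prob_space M by (rule prob)
  obtain U grad_P where U: "profiles blk X \<subseteq> U" "\<And>z. z \<in> U \<Longrightarrow> GDERIV P z :> grad_P z"
    "continuous_on U grad_P"
    using A2_smooth by blast
  have compact: "compact (profiles blk X)" and convex: "convex (profiles blk X)"
    using A1a by (auto intro: compact_profiles convex_profiles)
  obtain K where "K-lipschitz_on (profiles blk X) P"
    using C1_lipschitz_on_compact_convex[OF compact convex U] .
  then interpret lipschitz_potential_game blk X f P K
    using X_sub A1a A2_potential by unfold_locales auto

  \<comment> \<open>The summability of the errors and the independence of the picks are given from step 1 on;
      dropping step 0 changes neither convergence nor limit points.\<close>
  define F where "F n = info M (x 0) pick m samp (Suc n)" for n
  have F_subalg: "subalgebra M (F n)" for n
    unfolding F_def using x0_meas pick_meas m_meas samp_meas by (rule subalgebra_info)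
  have F_mono: "subalgebra (F n) (F j)" if "j \<le> n" for j n
    unfolding F_def using that by (intro subalgebra_info_mono) simp
  have x_in: "x k w \<in> profiles blk X" if "w \<in> space M" for k w
  proof (induction k)
    case (Suc k)
    show ?case
      using step[OF that refl, of k] step_in[OF that refl, of k] Suc deviate_in by simp
  qed (rule x0_in[OF that])
  have gain_cont: "continuous_on (profiles blk X) (gain blk X f i)" for i
    by (rule lipschitz_on_continuous_on[OF gain_lipschitz])

  have errors: "AE w in M. \<forall>i. summable (\<lambda>n. norm (\<epsilon> i (Suc (Suc n)) w))"
  proof (subst AE_all_countable, rule allI)
    fix i
    have "AE w in M. (\<Sum>n. nn_cond_exp M (F n) (\<lambda>w. ennreal (norm (\<epsilon> i (Suc (Suc n)) w))) w) < \<infinity>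
        \<longrightarrow> (\<Sum>n. ennreal (norm (\<epsilon> i (Suc (Suc n)) w))) < \<infinity>"
      by (rule AE_summable_if_cond_exp_summable[where F = F,
            OF finite_measure_axioms F_subalg F_mono])
        (assumption, rule measurable_compose[OF
            measurable_compose[OF eps_meas borel_measurable_norm] measurable_ennreal])
    moreover have "AE w in M. (\<Sum>n. nn_cond_exp M (F n) (\<lambda>w. ennreal (norm (\<epsilon> i (Suc (Suc n)) w))) w) < \<infinity>"
      using A3_norm[of i] unfolding F_def .
    ultimately have "AE w in M. (\<Sum>n. ennreal (norm (\<epsilon> i (Suc (Suc n)) w))) < \<infinity>"
      by (rule AE_mp[rotated])
    then show "AE w in M. summable (\<lambda>n. norm (\<epsilon> i (Suc (Suc n)) w))"
    proof (rule AE_mp, intro AE_I2 impI)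
      fix w assume "(\<Sum>n. ennreal (norm (\<epsilon> i (Suc (Suc n)) w))) < \<infinity>"
      then show "summable (\<lambda>n. norm (\<epsilon> i (Suc (Suc n)) w))"
        by (intro summable_suminf_not_top norm_ge_zero) (rule less_imp_neq, simp only: infinity_ennreal_def)
    qed
  qed

  have gains: "AE w in M. \<forall>i. summable (\<lambda>n. if w \<in> {w \<in> space M. pick (Suc n) w = i}
        then gain blk X f i (x (Suc n) w) else 0)
      \<longrightarrow> summable (\<lambda>n. gain blk X f i (x (Suc n) w))"
  proof (subst AE_all_countable, rule allI)
    fix i
    obtain B where B: "\<And>z. z \<in> profiles blk X \<Longrightarrow> gain blk X f i z \<le> B"
      using compact_imp_bounded[OF compact_continuous_image[OF gain_cont compact], of i]
      unfolding bounded_iff by (metis abs_le_D1 image_eqI real_norm_def)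
    show "AE w in M. summable (\<lambda>n. if w \<in> {w \<in> space M. pick (Suc n) w = i}
        then gain blk X f i (x (Suc n) w) else 0)
      \<longrightarrow> summable (\<lambda>n. gain blk X f i (x (Suc n) w))"
    proof (rule AE_summable_of_summable_on_indep_events[where F = F and q = "p i" and B = B
          and \<E> = "\<lambda>n. sets (vimage_algebra (space M) (pick (Suc n)) (count_space UNIV))"])
      fix n
      show "indep_set (sets (vimage_algebra (space M) (pick (Suc n)) (count_space UNIV))) (sets (F n))"
        unfolding F_def by (rule A3_indep) simp
      have "{w \<in> space M. pick (Suc n) w = i} = pick (Suc n) -` {i} \<inter> space M" by auto
      then show "{w \<in> space M. pick (Suc n) w = i}
          \<in> sets (vimage_algebra (space M) (pick (Suc n)) (count_space UNIV))"
        by (simp add: in_vimage_algebra)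
      show "{w \<in> space M. pick (Suc n) w = i} \<in> sets (F (Suc n))"
        unfolding F_def by (rule pick_in_info) simp
      \<comment> \<open>The gain is continuous on joint strategies, hence extended by 0 to a Borel function.\<close>
      have "(\<lambda>w. indicator (profiles blk X) (x (Suc n) w) *\<^sub>R gain blk X f i (x (Suc n) w))
          \<in> borel_measurable (F n)"
        unfolding F_def using compact
        by (intro measurable_compose[OF adapted borel_measurable_continuous_on_indicator] gain_cont)
          (simp add: compact_imp_closed)
      then show "(\<lambda>w. gain blk X f i (x (Suc n) w)) \<in> borel_measurable (F n)"
        by (rule measurable_cong[THEN iffD1, rotated]) (simp add: F_def x_in)
    qed (auto intro: F_subalg F_mono pick_prob gain_nonneg x_in B simp: p_bounds)
  qed

  have "AE w in M. w \<in> space M" by simp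
  with errors gains show ?thesis
  proof eventually_elim
    case (elim w)
    note w = elim(3)
    have errors_of_movers: "summable (\<lambda>n. norm (\<epsilon> (pick (Suc n) w) (Suc (Suc n)) w))"
    proof (rule summable_comparison_test')
      show "summable (\<lambda>n. \<Sum>i\<in>UNIV. norm (\<epsilon> i (Suc (Suc n)) w))"
        using elim(1) by (intro summable_sum) auto
      show "norm (norm (\<epsilon> (pick (Suc n) w) (Suc (Suc n)) w))
          \<le> (\<Sum>i\<in>UNIV. norm (\<epsilon> i (Suc (Suc n)) w))" for n
        using member_le_sum[of "pick (Suc n) w" UNIV "\<lambda>i. norm (\<epsilon> i (Suc (Suc n)) w)"] by simp
    qed
    have movers: "summable (\<lambda>n. gain blk X f (pick (Suc n) w) (x (Suc n) w))"
    proof (rule summable_gain_of_movers[where z = "\<lambda>n. x (Suc n) w"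
          and i = "\<lambda>n. pick (Suc n) w" and e = "\<lambda>n. \<epsilon> (pick (Suc n) w) (Suc (Suc n)) w"])
      fix n
      show "x (Suc n) w \<in> profiles blk X" by (rule x_in[OF w])
      show "best_response blk X f (pick (Suc n) w) (x (Suc n) w)
          + \<epsilon> (pick (Suc n) w) (Suc (Suc n)) w \<in> X (pick (Suc n) w)"
        by (rule step_in[OF w refl])
      show "x (Suc (Suc n)) w = deviate blk (pick (Suc n) w)
          (best_response blk X f (pick (Suc n) w) (x (Suc n) w)
            + \<epsilon> (pick (Suc n) w) (Suc (Suc n)) w) (x (Suc n) w)"
        by (rule step[OF w refl])
    qed (rule errors_of_movers)
    have gain_0: "(\<lambda>n. gain blk X f i (x n w)) \<longlonglongrightarrow> 0" for i
    proof -
      have "summable (\<lambda>n. if w \<in> {w \<in> space M. pick (Suc n) w = i}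
          then gain blk X f i (x (Suc n) w) else 0)"
      proof (rule summable_comparison_test'[OF movers])
        show "norm (if w \<in> {w \<in> space M. pick (Suc n) w = i} then gain blk X f i (x (Suc n) w) else 0)
            \<le> gain blk X f (pick (Suc n) w) (x (Suc n) w)" for n
          using gain_nonneg[OF x_in[OF w]] by simp
      qed
      then have "summable (\<lambda>n. gain blk X f i (x (Suc n) w))" by (rule elim(2)[rule_format])
      then show ?thesis by (rule LIMSEQ_imp_Suc[OF summable_LIMSEQ_zero])
    qed
    show ?case
    proof (intro allI impI, elim exE conjE)
      fix z r assume r: "strict_mono r" and lim: "((\<lambda>k. x k w) \<circ> r) \<longlonglongrightarrow> z"
      have z: "z \<in> profiles blk X"
        by (rule closed_sequentially[OF compact_imp_closed[OF compact] _ lim]) (simp add: x_in w)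
      show "nash_equilibrium blk X f z"
      proof (rule nash_equilibrium_if_no_gain[OF z])
        fix i
        have "(\<lambda>k. gain blk X f i (((\<lambda>k. x k w) \<circ> r) k)) \<longlonglongrightarrow> gain blk X f i z"
          by (rule continuous_on_tendsto_compose[OF gain_cont lim z]) (simp add: x_in w)
        moreover have "(\<lambda>k. gain blk X f i (((\<lambda>k. x k w) \<circ> r) k)) \<longlonglongrightarrow> 0"
          using LIMSEQ_subseq_LIMSEQ[OF gain_0 r] by (simp add: comp_def)
        ultimately have "gain blk X f i z = 0" by (rule LIMSEQ_unique)
        then show "gain blk X f i z \<le> 0" by simp
      qed
    qed
  qed
qed

end
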